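(* Let $K$ be a field with $\mathrm{char}\,K\neq2$ and let $G$ be an algebraic supergroup over $K$ with $\mathfrak m=\ker\epsilon_G$. The adjoint action of $G$ on $\mathsf{Lie}(G)_a\simeq\mathbf{Lie}(G)$ commutes with the Lie bracket: for every supercommutative $K$-superalgebra $A$, every $g\in G(A)$ and all $u,v\in\mathsf{Hom}_K(\mathfrak m/\mathfrak m^2,A)\simeq\mathsf{Lie}(G)\otimes A$, $$[\mathsf{Ad}(g)u,\mathsf{Ad}(g)v]=\mathsf{Ad}(g)[u,v].$$
   Context: An algebraic supergroup $G$ is a group-valued functor on supercommutative $K$-superalgebras represented by a finitely generated supercommutative Hopf superalgebra $K[G]$ with comultiplication $\Delta_G(f)=\sum f_1\otimes f_2$, counit $\epsilon_G$, antipode $s_G$. $\mathsf{Lie}(G)=(\mathfrak m/\mathfrak m^2)^*$, and $\mathsf{Lie}(G)_a(A)=\mathsf{Lie}(G)\otimes A$. For a supercommutative superalgebra $A$, $\mathsf{Hom}_K(K[G],A)$ is an associative superalgebra under the convolution $(\phi\star\psi)(f)=\sum(-1)^{|\psi||f_1|}\phi(f_1)\psi(f_2)$, with unit $\epsilon_G$, and a Lie superalgebra under $[\phi,\psi]=\phi\star\psi-(-1)^{|\phi||\psi|}\psi\star\phi$. The superspace $\mathsf{Hom}_K(\mathfrak m/\mathfrak m^2,A)$ (maps vanishing on $1$ and $\mathfrak m^2$) is a Lie supersubalgebra of it, isomorphic to $\mathsf{Lie}(G)\otimes A$ via $(v\otimes a)(f)=(-1)^{|a||f|}v(f)a$. The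 adjoint action of $g\in G(A)$ on $u\in\mathsf{Hom}_K(\mathfrak m/\mathfrak m^2,A)$ is $$(\mathsf{Ad}(g)u)(f)=\sum(-1)^{|u||f_1|}g(f_1)u(f_2)g(s_G(f_3)),\quad f\in\mathfrak m,$$ corresponding to the conjugation action of $G$ on $\mathbf{Lie}(G)(A)=\ker(G(A[\epsilon_0,\epsilon_1])\to G(A))$, where $A[\epsilon_0,\epsilon_1]$ is the superalgebra of dual numbers ($|\epsilon_i|=i$, $\epsilon_i\epsilon_j=0$). *)

theory Defs
  imports Complex_Main "HOL-Library.Poly_Mapping" "HOL-Library.Z2"
begin

section \<open>Superspaces and superalgebras\<close>

text \<open>
  Parities are elements of the two-element field \<open>bit\<close>. All (super)spaces live on a whole type.
  Unital rings are taken in the sort \<open>{ring, monoid_mult}\<close> rather than \<open>ring_1\<close>, so that the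
  zero superalgebra is not excluded.
\<close>

record ('k, 'v) superspace =
  smult :: "'k \<Rightarrow> 'v \<Rightarrow> 'v"
  gr :: "bit \<Rightarrow> 'v set"

locale superspace =
  fixes V :: "('k::field, 'v::ab_group_add, 'm) superspace_scheme"
  assumes vector_space: "vector_space (smult V)"
    and gr_subspace: "module.subspace (smult V) (gr V i)"
    and gr_sum: "\<exists>x\<in>gr V 0. \<exists>y\<in>gr V 1. v = x + y"
    and gr_inter: "gr V 0 \<inter> gr V 1 = {0}"

definition part :: "('k, 'v::ab_group_add, 'm) superspace_scheme \<Rightarrow> bit \<Rightarrow> 'v \<Rightarrow> 'v" where
  "part V i v = (THE x. x \<in> gr V i \<and> v - x \<in> gr V (i + 1))"

definition koszul :: "bit \<Rightarrow> bit \<Rightarrow> 'k::ring_1" where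
  "koszul i j = (if i = 1 \<and> j = 1 then - 1 else 1)"

locale superalgebra = superspace A
  for A :: "('k::field, 'a::{ring,monoid_mult}, 'm) superspace_scheme" +
  assumes smult_mult_left: "smult A c x * y = smult A c (x * y)"
    and smult_mult_right: "x * smult A c y = smult A c (x * y)"
    and gr_one: "1 \<in> gr A 0"
    and gr_mult: "x \<in> gr A i \<Longrightarrow> y \<in> gr A j \<Longrightarrow> x * y \<in> gr A (i + j)"

text \<open>In characteristic different from 2 the condition implies that odd elements square to zero.\<close>

locale supercommutative_superalgebra = superalgebra +
  assumes supercommute: "x \<in> gr A i \<Longrightarrow> y \<in> gr A j \<Longrightarrow> x * y = smult A (koszul i j) (y * x)"

definition superalgebra_hom ::
  "('k::field, 'a::{ring,monoid_mult}, 'm) superspace_scheme \<Rightarrow>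
   ('k, 'b::{ring,monoid_mult}, 'n) superspace_scheme \<Rightarrow> ('a \<Rightarrow> 'b) \<Rightarrow> bool" where
  "superalgebra_hom A B g \<longleftrightarrow>
     Vector_Spaces.linear (smult A) (smult B) g \<and> (\<forall>i. g ` gr A i \<subseteq> gr B i) \<and>
     (\<forall>x y. g (x * y) = g x * g y) \<and> g 1 = 1"

definition finitely_generated ::
  "('k::field, 'a::{ring,monoid_mult}, 'm) superspace_scheme \<Rightarrow> bool" where
  "finitely_generated A \<longleftrightarrow>
     (\<exists>S. finite S \<and>
        (\<forall>B. S \<subseteq> B \<and> 1 \<in> B \<and> module.subspace (smult A) B \<and> (\<forall>x\<in>B. \<forall>y\<in>B. x * y \<in> B)
             \<longrightarrow> B = UNIV))"


section \<open>Tensor powers\<close>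

text \<open>
  \<open>H \<otimes> H\<close> is the free vector space on \<open>H \<times> H\<close> modulo the subspace \<open>tensor2_rel\<close> spanned by the
  bilinearity relations, and \<open>H \<otimes> H \<otimes> H\<close> is likewise the free space on triples modulo the
  trilinearity relations. Since the relations depend on the scalar multiplication of \<open>H\<close>, which is
  a term, the quotient is not a type; its elements are handled through representatives,
  i.e. formal sums, and equality in the tensor power is \<open>tensor2_eq\<close> or \<open>tensor3_eq\<close>.
\<close>

abbreviation pure :: "'b \<Rightarrow> ('b \<Rightarrow>\<^sub>0 'k::field)" where
  "pure b \<equiv> Poly_Mapping.single b 1"

definition fscale :: "'k::field \<Rightarrow> ('b \<Rightarrow>\<^sub>0 'k) \<Rightarrow> ('b \<Rightarrow>\<^sub>0 'k)" where
  "fscale c = Poly_Mapping.map ((*) c)"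

text \<open>Linear extension of a map on the basis of a free vector space, with values in a space with
  scalar multiplication \<open>s\<close>.\<close>

definition flift ::
  "('k::field \<Rightarrow> 'v::ab_group_add \<Rightarrow> 'v) \<Rightarrow> ('b \<Rightarrow> 'v) \<Rightarrow> ('b \<Rightarrow>\<^sub>0 'k) \<Rightarrow> 'v" where
  "flift s B t = (\<Sum>b\<in>Poly_Mapping.keys t. s (Poly_Mapping.lookup t b) (B b))"

definition tensor2_rel ::
  "('k::field, 'h::ab_group_add, 'm) superspace_scheme \<Rightarrow> (('h \<times> 'h) \<Rightarrow>\<^sub>0 'k) set" where
  "tensor2_rel H = module.span fscale
     ({pure (x + x', y) - pure (x, y) - pure (x', y) | x x' y. True} \<union>
      {pure (x, y + y') - pure (x, y) - pure (x, y') | x y y'. True} \<union>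
      {pure (smult H c x, y) - fscale c (pure (x, y)) | c x y. True} \<union>
      {pure (x, smult H c y) - fscale c (pure (x, y)) | c x y. True})"

definition tensor2_eq ::
  "('k::field, 'h::ab_group_add, 'm) superspace_scheme \<Rightarrow>
   (('h \<times> 'h) \<Rightarrow>\<^sub>0 'k) \<Rightarrow> (('h \<times> 'h) \<Rightarrow>\<^sub>0 'k) \<Rightarrow> bool" where
  "tensor2_eq H t t' \<longleftrightarrow> t - t' \<in> tensor2_rel H"

definition tensor3_rel ::
  "('k::field, 'h::ab_group_add, 'm) superspace_scheme \<Rightarrow> (('h \<times> 'h \<times> 'h) \<Rightarrow>\<^sub>0 'k) set" where
  "tensor3_rel H = module.span fscale
     ({pure (x + x', y, z) - pure (x, y, z) - pure (x', y, z) | x x' y z. True} \<union>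
      {pure (x, y + y', z) - pure (x, y, z) - pure (x, y', z) | x y y' z. True} \<union>
      {pure (x, y, z + z') - pure (x, y, z) - pure (x, y, z') | x y z z'. True} \<union>
      {pure (smult H c x, y, z) - fscale c (pure (x, y, z)) | c x y z. True} \<union>
      {pure (x, smult H c y, z) - fscale c (pure (x, y, z)) | c x y z. True} \<union>
      {pure (x, y, smult H c z) - fscale c (pure (x, y, z)) | c x y z. True})"

definition tensor3_eq ::
  "('k::field, 'h::ab_group_add, 'm) superspace_scheme \<Rightarrow>
   (('h \<times> 'h \<times> 'h) \<Rightarrow>\<^sub>0 'k) \<Rightarrow> (('h \<times> 'h \<times> 'h) \<Rightarrow>\<^sub>0 'k) \<Rightarrow> bool" where
  "tensor3_eq H t t' \<longleftrightarrow> t - t' \<in> tensor3_rel H"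

definition tensor2_gr ::
  "('k::field, 'h::ab_group_add, 'm) superspace_scheme \<Rightarrow> bit \<Rightarrow> (('h \<times> 'h) \<Rightarrow>\<^sub>0 'k) set" where
  "tensor2_gr H i =
     module.span fscale {pure (x, y) | x y j k. x \<in> gr H j \<and> y \<in> gr H k \<and> j + k = i}"

text \<open>The product \<open>(a \<otimes> b)(c \<otimes> d) = (-1)\<^bsup>|b||c|\<^esup> ac \<otimes> bd\<close>, where \<open>b\<close> and \<open>c\<close> are decomposed
  into their homogeneous components.\<close>

definition tensor2_mult ::
  "('k::field, 'h::{ring,monoid_mult}, 'm) superspace_scheme \<Rightarrow>
   (('h \<times> 'h) \<Rightarrow>\<^sub>0 'k) \<Rightarrow> (('h \<times> 'h) \<Rightarrow>\<^sub>0 'k) \<Rightarrow> (('h \<times> 'h) \<Rightarrow>\<^sub>0 'k)" where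
  "tensor2_mult H t t' =
     flift fscale (\<lambda>(a, b). flift fscale (\<lambda>(c, d).
       \<Sum>i\<in>{0,1}. \<Sum>j\<in>{0,1}. fscale (koszul i j) (pure (a * part H j c, part H i b * d))) t') t"


section \<open>Algebraic supergroups\<close>

text \<open>
  An algebraic supergroup \<open>G\<close> is given by its coordinate superalgebra \<open>K[G]\<close>. The formal sum
  \<open>comult H f\<close> represents the element \<open>\<Delta>(f) = \<Sum> f\<^sub>1 \<otimes> f\<^sub>2\<close> of \<open>H \<otimes> H\<close>; no particular choice of
  representatives is imposed, all axioms are identities in the tensor powers.
\<close>

record (overloaded) ('k::zero, 'h) hopf = "('k, 'h) superspace" +
  comult :: "'h \<Rightarrow> (('h \<times> 'h) \<Rightarrow>\<^sub>0 'k)"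
  counit :: "'h \<Rightarrow> 'k"
  antipode :: "'h \<Rightarrow> 'h"

text \<open>\<open>(\<Delta> \<otimes> id) \<Delta> f = \<Sum> f\<^sub>1 \<otimes> f\<^sub>2 \<otimes> f\<^sub>3\<close>\<close>

definition comult3 ::
  "('k::field, 'h::ab_group_add, 'm) hopf_scheme \<Rightarrow> 'h \<Rightarrow> (('h \<times> 'h \<times> 'h) \<Rightarrow>\<^sub>0 'k)" where
  "comult3 H f =
     flift fscale (\<lambda>(x, y). flift fscale (\<lambda>(a, b). pure (a, b, y)) (comult H x)) (comult H f)"

locale hopf_superalgebra = superalgebra H
  for H :: "('k::field, 'h::{ring,monoid_mult}, 'm) hopf_scheme" +
  assumes comult_add: "tensor2_eq H (comult H (x + y)) (comult H x + comult H y)"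
    and comult_smult: "tensor2_eq H (comult H (smult H c x)) (fscale c (comult H x))"
    and comult_gr: "x \<in> gr H i \<Longrightarrow> \<exists>t\<in>tensor2_gr H i. tensor2_eq H (comult H x) t"
    and comult_mult: "tensor2_eq H (comult H (x * y)) (tensor2_mult H (comult H x) (comult H y))"
    and comult_one: "tensor2_eq H (comult H 1) (pure (1, 1))"
    and counit_linear: "Vector_Spaces.linear (smult H) (*) (counit H)"
    and counit_odd: "x \<in> gr H 1 \<Longrightarrow> counit H x = 0"
    and counit_mult: "counit H (x * y) = counit H x * counit H y"
    and counit_one: "counit H 1 = 1"
    and coassoc: "tensor3_eq H (comult3 H x)
      (flift fscale (\<lambda>(a, b). flift fscale (\<lambda>(c, d). pure (a, c, d)) (comult H b)) (comult H x))"
    and counit_left: "flift (smult H) (\<lambda>(a, b). smult H (counit H a) b) (comult H x) = x"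
    and counit_right: "flift (smult H) (\<lambda>(a, b). smult H (counit H b) a) (comult H x) = x"
    and antipode_linear: "Vector_Spaces.linear (smult H) (smult H) (antipode H)"
    and antipode_gr: "x \<in> gr H i \<Longrightarrow> antipode H x \<in> gr H i"
    and antipode_left:
      "flift (smult H) (\<lambda>(a, b). antipode H a * b) (comult H x) = smult H (counit H x) 1"
    and antipode_right:
      "flift (smult H) (\<lambda>(a, b). a * antipode H b) (comult H x) = smult H (counit H x) 1"

locale algebraic_supergroup = hopf_superalgebra H + supercommutative_superalgebra H
  for H :: "('k::field, 'h::{ring,monoid_mult}, 'm) hopf_scheme" +
  assumes fin_gen: "finitely_generated H"

text \<open>\<open>G(A)\<close>\<close>

definition points ::
  "('k::field, 'h::{ring,monoid_mult}, 'm) hopf_scheme \<Rightarrow>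
   ('k, 'a::{ring,monoid_mult}, 'n) superspace_scheme \<Rightarrow> ('h \<Rightarrow> 'a) set" where
  "points H A = {g. superalgebra_hom H A g}"


section \<open>The Lie superalgebra and the adjoint action\<close>

definition aug_ideal :: "('k::field, 'h, 'm) hopf_scheme \<Rightarrow> 'h set" where
  "aug_ideal H = {f. counit H f = 0}"

definition aug_ideal_sq :: "('k::field, 'h::ring, 'm) hopf_scheme \<Rightarrow> 'h set" where
  "aug_ideal_sq H = module.span (smult H) {x * y | x y. x \<in> aug_ideal H \<and> y \<in> aug_ideal H}"

text \<open>\<open>Hom\<^sub>K(\<mm>/\<mm>\<^sup>2, A)\<close>, as the space of linear maps (not necessarily homogeneous) on \<open>K[G]\<close> that
  vanish on \<open>1\<close> and on \<open>\<mm>\<^sup>2\<close>\<close>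

definition lie_maps ::
  "('k::field, 'h::{ring,monoid_mult}, 'm) hopf_scheme \<Rightarrow>
   ('k, 'a::{ring,monoid_mult}, 'n) superspace_scheme \<Rightarrow> ('h \<Rightarrow> 'a) set" where
  "lie_maps H A = {u. Vector_Spaces.linear (smult H) (smult A) u \<and> u 1 = 0 \<and>
                      (\<forall>f\<in>aug_ideal_sq H. u f = 0)}"

text \<open>The component of parity \<open>i\<close> of a linear map, i.e. its component mapping each \<open>H\<^sub>j\<close> into
  \<open>A\<^bsub>i+j\<^esub>\<close>\<close>

definition map_part ::
  "('k, 'h::ab_group_add, 'm) superspace_scheme \<Rightarrow> ('k, 'a::ab_group_add, 'n) superspace_scheme \<Rightarrow>
   bit \<Rightarrow> ('h \<Rightarrow> 'a) \<Rightarrow> ('h \<Rightarrow> 'a)" where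
  "map_part H A i \<phi> = (\<lambda>f. \<Sum>j\<in>{0,1}. part A (i + j) (\<phi> (part H j f)))"

text \<open>
  The three definitions below extend the usual formulas with signs from homogeneous to arbitrary
  arguments by (bi)linearity:
  \<open>(\<phi> \<star> \<psi>)(f) = \<Sum> (-1)\<^bsup>|\<psi>||f\<^sub>1|\<^esup> \<phi>(f\<^sub>1) \<psi>(f\<^sub>2)\<close>,
  \<open>[\<phi>, \<psi>] = \<phi> \<star> \<psi> - (-1)\<^bsup>|\<phi>||\<psi>|\<^esup> \<psi> \<star> \<phi>\<close> and
  \<open>(Ad(g) u)(f) = \<Sum> (-1)\<^bsup>|u||f\<^sub>1|\<^esup> g(f\<^sub>1) u(f\<^sub>2) g(s(f\<^sub>3))\<close>.
  The last one is used for all \<open>f\<close> rather than for \<open>f \<in> \<mm>\<close> only; it gives \<open>0\<close> at \<open>f = 1\<close>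
  because \<open>u(1) = 0\<close>, as it must for an element of \<open>Hom\<^sub>K(\<mm>/\<mm>\<^sup>2, A)\<close>.
\<close>

definition conv ::
  "('k::field, 'h::ab_group_add, 'm) hopf_scheme \<Rightarrow>
   ('k, 'a::{ring,monoid_mult}, 'n) superspace_scheme \<Rightarrow>
   ('h \<Rightarrow> 'a) \<Rightarrow> ('h \<Rightarrow> 'a) \<Rightarrow> ('h \<Rightarrow> 'a)" where
  "conv H A \<phi> \<psi> = (\<lambda>f. flift (smult A)
     (\<lambda>(x, y). \<Sum>i\<in>{0,1}. \<Sum>j\<in>{0,1}.
        smult A (koszul i j) (\<phi> (part H j x) * map_part H A i \<psi> y)) (comult H f))"

definition lie_bracket ::
  "('k::field, 'h::ab_group_add, 'm) hopf_scheme \<Rightarrow>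
   ('k, 'a::{ring,monoid_mult}, 'n) superspace_scheme \<Rightarrow>
   ('h \<Rightarrow> 'a) \<Rightarrow> ('h \<Rightarrow> 'a) \<Rightarrow> ('h \<Rightarrow> 'a)" where
  "lie_bracket H A \<phi> \<psi> = (\<lambda>f. conv H A \<phi> \<psi> f -
     (\<Sum>i\<in>{0,1}. \<Sum>j\<in>{0,1}.
        smult A (koszul i j) (conv H A (map_part H A j \<psi>) (map_part H A i \<phi>) f)))"

definition Ad ::
  "('k::field, 'h::{ring,monoid_mult}, 'm) hopf_scheme \<Rightarrow>
   ('k, 'a::{ring,monoid_mult}, 'n) superspace_scheme \<Rightarrow>
   ('h \<Rightarrow> 'a) \<Rightarrow> ('h \<Rightarrow> 'a) \<Rightarrow> ('h \<Rightarrow> 'a)" where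
  "Ad H A g u = (\<lambda>f. flift (smult A)
     (\<lambda>(x, y, z). \<Sum>i\<in>{0,1}. \<Sum>j\<in>{0,1}.
        smult A (koszul i j) (g (part H j x) * map_part H A i u y * g (antipode H z)))
     (comult3 H f))"

end

(* With respect to the convolution product * the adjoint action is conjugation,
   Ad(g) u = g * u * (g o s), and g o s is the convolution inverse of g since g is an algebra map.
   Convolution is associative and respects parities, so this conjugation is an even automorphism
   of the convolution superalgebra and commutes with the supercommutator. *)

theory Submission
  imports Defs "HOL-Library.Function_Algebras"
begin

section \<open>Linear extensions\<close>

lemma lookup_fscale [simp]: "Poly_Mapping.lookup (fscale c t) b = c * Poly_Mapping.lookup t b"
  by (cases "Poly_Mapping.lookup t b = 0") (auto simp: fscale_def map.rep_eq when_def)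

lemma vector_space_fscale: "vector_space (fscale :: 'k::field \<Rightarrow> ('b \<Rightarrow>\<^sub>0 'k) \<Rightarrow> ('b \<Rightarrow>\<^sub>0 'k))"
  by unfold_locales (auto intro!: poly_mapping_eqI simp: lookup_add algebra_simps)

interpretation fscale: vector_space "fscale :: 'k::field \<Rightarrow> ('b \<Rightarrow>\<^sub>0 'k) \<Rightarrow> ('b \<Rightarrow>\<^sub>0 'k)"
  by (rule vector_space_fscale)

context vector_space
begin

text \<open>Keys outside the support carry coefficient 0. Enlarging the index set lets several
  formal sums be evaluated over one common finite set, although cancellation can make the support of
  a sum smaller than the union of the supports.\<close>

lemma flift_superset:
  assumes "finite S" "Poly_Mapping.keys t \<subseteq> S"
  shows "flift scale B t = (\<Sum>b\<in>S. scale (Poly_Mapping.lookup t b) (B b))"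
  unfolding flift_def using assms
  by (intro sum.mono_neutral_left) (auto simp: in_keys_iff)

lemma flift_linear: "Vector_Spaces.linear fscale scale (flift scale B)"
proof -
  have "flift scale B (t + t') = flift scale B t + flift scale B t'" for t t'
  proof -
    let ?S = "Poly_Mapping.keys t \<union> Poly_Mapping.keys t'"
    have "Poly_Mapping.keys (t + t') \<subseteq> ?S" by (rule keys_add)
    then show ?thesis
      by (simp add: flift_superset[of ?S] lookup_add scale_left_distrib sum.distrib)
  qed
  moreover have "flift scale B (fscale c t) = scale c (flift scale B t)" for c t
  proof -
    \<comment> \<open>An inclusion is all that holds in general: scaling by 0 empties the
      support.\<close>
    have "Poly_Mapping.keys (fscale c t) \<subseteq> Poly_Mapping.keys t" by (auto simp: in_keys_iff)
    then show ?thesis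
      by (simp add: flift_superset[of "Poly_Mapping.keys t"] scale_sum_right)
  qed
  ultimately show ?thesis
    by (simp add: Vector_Spaces.linear_iff vector_space_fscale vector_space_axioms)
qed

lemma flift_pure [simp]: "flift scale B (pure b) = B b"
  by (simp add: flift_def)

lemma flift_fun_add: "flift scale (\<lambda>b. B b + B' b) t = flift scale B t + flift scale B' t"
  by (simp add: flift_def scale_right_distrib sum.distrib)

end

lemma linear_flift:
  assumes "Vector_Spaces.linear s s' h"
  shows "h (flift s B t) = flift s' (\<lambda>b. h (B b)) t"
proof -
  interpret Vector_Spaces.linear s s' h by fact
  show ?thesis by (simp add: flift_def sum scale)
qed

lemma linear_eqI_span:
  assumes "Vector_Spaces.linear s s' L" "Vector_Spaces.linear s s' L'"
    and "\<And>b. b \<in> B \<Longrightarrow> L b = L' b" and "x \<in> module.span s B"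
  shows "L x = L' x"
proof -
  interpret L: Vector_Spaces.linear s s' L by fact
  interpret vector_space_pair s s' ..
  show ?thesis using linear_eq_on_span[OF assms(1,2,3,4)] .
qed

text \<open>The universal property of \<open>H \<otimes> H\<close>: the linear extension of a
  bilinear map kills each generating relation, hence their span, and so depends only on the tensor
  that a formal sum represents.\<close>

lemma flift_tensor2_eq:
  assumes "vector_space s" and "tensor2_eq H t t'"
    and "\<And>x x' y. B (x + x', y) = B (x, y) + B (x', y)"
    and "\<And>x y y'. B (x, y + y') = B (x, y) + B (x, y')"
    and "\<And>c x y. B (smult H c x, y) = s c (B (x, y))"
    and "\<And>c x y. B (x, smult H c y) = s c (B (x, y))"
  shows "flift s B t = flift s B t'"
proof -
  interpret vector_space s by fact
  interpret L: Vector_Spaces.linear fscale s "flift s B" by (rule flift_linear)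
  have "flift s B (t - t') = 0"
    using assms(2) unfolding tensor2_eq_def tensor2_rel_def
    by (rule L.eq_0_on_span[rotated]) (auto simp: L.diff L.scale assms)
  then show ?thesis by (simp add: L.diff)
qed

text \<open>The same argument for trilinear maps and \<open>H \<otimes> H \<otimes> H\<close>; this
  is how coassociativity becomes usable.\<close>

lemma flift_tensor3_eq:
  assumes "vector_space s" and "tensor3_eq H t t'"
    and "\<And>x x' y z. B (x + x', y, z) = B (x, y, z) + B (x', y, z)"
    and "\<And>x y y' z. B (x, y + y', z) = B (x, y, z) + B (x, y', z)"
    and "\<And>x y z z'. B (x, y, z + z') = B (x, y, z) + B (x, y, z')"
    and "\<And>c x y z. B (smult H c x, y, z) = s c (B (x, y, z))"
    and "\<And>c x y z. B (x, smult H c y, z) = s c (B (x, y, z))"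
    and "\<And>c x y z. B (x, y, smult H c z) = s c (B (x, y, z))"
  shows "flift s B t = flift s B t'"
proof -
  interpret vector_space s by fact
  interpret L: Vector_Spaces.linear fscale s "flift s B" by (rule flift_linear)
  have "flift s B (t - t') = 0"
    using assms(2) unfolding tensor3_eq_def tensor3_rel_def
    by (rule L.eq_0_on_span[rotated]) (auto simp: L.diff L.scale assms)
  then show ?thesis by (simp add: L.diff)
qed


section \<open>Homogeneous components\<close>

declare add_bit_eq_xor [simp del]

lemma bit_add_self [simp]: "(i::bit) + i = 0"
  by (cases i) (simp_all add: add_bit_eq_xor)

sublocale superspace \<subseteq> scalar: vector_space "smult V"
  by (rule vector_space)

context superspace
begin

lemma gr_disjoint: "x \<in> gr V i \<Longrightarrow> x \<in> gr V (i + 1) \<Longrightarrow> x = 0"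
  using gr_inter by (cases i) auto

lemmas gr_zero = scalar.subspace_0[OF gr_subspace]
  and gr_add = scalar.subspace_add[OF gr_subspace]
  and gr_diff = scalar.subspace_diff[OF gr_subspace]
  and gr_smult = scalar.subspace_scale[OF gr_subspace]

text \<open>Two candidates for the component differ by an element of both graded pieces, which is 0.
  This evaluates the definite description in \<open>part\<close>.\<close>

lemma part_unique:
  assumes "x \<in> gr V i" "v - x \<in> gr V (i + 1)"
  shows "part V i v = x"
  unfolding part_def
proof (rule the_equality)
  fix y assume y: "y \<in> gr V i \<and> v - y \<in> gr V (i + 1)"
  have "y - x = (v - x) - (v - y)" by simp
  then have "y - x \<in> gr V (i + 1)" using y assms gr_diff by metis
  moreover have "y - x \<in> gr V i" using y assms by (simp add: gr_diff)
  ultimately show "y = x" using gr_disjoint by fastforce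
qed (use assms in simp)

text \<open>The decomposition read relative to \<open>i\<close>, so that one argument serves both
  parities; for \<open>i = 1\<close> the two summands trade places.\<close>

lemma part_eq_cases: "\<exists>x\<in>gr V i. \<exists>y\<in>gr V (i + 1). v = x + y"
  using gr_sum[of v] by (cases i) (simp, metis add.commute add_0_right bit_add_self)

lemma part_in_gr [simp]: "part V i v \<in> gr V i"
  and diff_part_in_gr: "v - part V i v \<in> gr V (i + 1)"
proof -
  obtain x y where "x \<in> gr V i" "y \<in> gr V (i + 1)" "v = x + y"
    using part_eq_cases by blast
  moreover from this have "part V i v = x" by (intro part_unique) auto
  ultimately show "part V i v \<in> gr V i" "v - part V i v \<in> gr V (i + 1)" by auto
qed

lemma part_gr: "x \<in> gr V i \<Longrightarrow> part V j x = (if i = j then x else 0)"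
  by (cases i; cases j) (auto intro!: part_unique simp: gr_zero)

lemma part_add [simp]: "part V i (v + w) = part V i v + part V i w"
proof (rule part_unique)
  have "v + w - (part V i v + part V i w) = (v - part V i v) + (w - part V i w)" by simp
  then show "v + w - (part V i v + part V i w) \<in> gr V (i + 1)"
    using gr_add diff_part_in_gr by metis
qed (simp add: gr_add)

lemma part_smult [simp]: "part V i (smult V c v) = smult V c (part V i v)"
proof (rule part_unique)
  show "smult V c v - smult V c (part V i v) \<in> gr V (i + 1)"
    using gr_smult[OF diff_part_in_gr] by (simp only: scalar.scale_right_diff_distrib)
qed (simp add: gr_smult)

lemma part_0 [simp]: "part V i 0 = 0"
  by (rule part_unique) (auto simp: gr_zero)

lemma part_diff [simp]: "part V i (v - w) = part V i v - part V i w"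
  by (metis add_diff_cancel diff_add_cancel part_add)

lemma part_sum: "part V 0 v + part V 1 v = v"
proof -
  have "part V 1 v = v - part V 0 v"
    using diff_part_in_gr[of v 0] by (intro part_unique) auto
  then show ?thesis by simp
qed

lemma homogeneous_induct:
  assumes "\<And>i x. x \<in> gr V i \<Longrightarrow> P x" "\<And>x y. P x \<Longrightarrow> P y \<Longrightarrow> P (x + y)"
  shows "P x"
  by (metis assms part_in_gr part_sum)

lemma homogeneous_eqI:
  assumes "Vector_Spaces.linear (smult V) s f" "Vector_Spaces.linear (smult V) s g"
    and "\<And>i x. x \<in> gr V i \<Longrightarrow> f x = g x"
  shows "f = g"
proof
  fix x show "f x = g x"
    by (rule homogeneous_induct[of _ x]) (use assms in \<open>auto simp: Vector_Spaces.linear_iff\<close>)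
qed

end

text \<open>The \<open>i\<close>-th power of the parity involution. It encodes the sign
  \<open>koszul i j\<close> on elements of parity \<open>j\<close> as a linear map, so that signs
  can be moved around by composing maps.\<close>

definition parity_pow :: "('k, 'v::ab_group_add, 'm) superspace_scheme \<Rightarrow> bit \<Rightarrow> 'v \<Rightarrow> 'v" where
  "parity_pow V i v = (if i = 0 then v else part V 0 v - part V 1 v)"

context superspace
begin

lemma parity_pow_linear: "Vector_Spaces.linear (smult V) (smult V) (parity_pow V i)"
  by (auto simp: Vector_Spaces.linear_iff vector_space parity_pow_def
      scalar.scale_right_diff_distrib)

lemma parity_pow_gr: "x \<in> gr V j \<Longrightarrow> parity_pow V i x = smult V (koszul i j) x"
  by (cases i; cases j) (auto simp: parity_pow_def koszul_def part_gr)

lemma parity_pow_parity_pow: "parity_pow V i (parity_pow V j v) = parity_pow V (i + j) v"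
  by (cases i; cases j) (auto simp: parity_pow_def part_gr[OF part_in_gr] part_sum)

end


section \<open>Convolution\<close>

locale convolution = H: hopf_superalgebra H + A: superalgebra A
  for H :: "('k::field, 'h::{ring,monoid_mult}, 'm) hopf_scheme"
    and A :: "('k, 'a::{ring,monoid_mult}, 'n) superspace_scheme"
begin

abbreviation lin :: "('h \<Rightarrow> 'a) \<Rightarrow> bool" where
  "lin \<equiv> Vector_Spaces.linear (smult H) (smult A)"

lemma lin_iff:
  "lin \<phi> \<longleftrightarrow> (\<forall>x y. \<phi> (x + y) = \<phi> x + \<phi> y) \<and> (\<forall>c x. \<phi> (smult H c x) = smult A c (\<phi> x))"
  by (simp add: Vector_Spaces.linear_iff H.vector_space A.vector_space)

lemma lin_0: "lin \<phi> \<Longrightarrow> \<phi> 0 = 0"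
  by (metis Vector_Spaces.linear.axioms(3) module_hom.zero)

lemma lin_add: "lin \<phi> \<Longrightarrow> lin \<psi> \<Longrightarrow> lin (\<phi> + \<psi>)"
  by (simp add: lin_iff A.scalar.scale_right_distrib)

lemma lin_diff: "lin \<phi> \<Longrightarrow> lin \<psi> \<Longrightarrow> lin (\<phi> - \<psi>)"
  by (simp add: lin_iff A.scalar.scale_right_diff_distrib)

section \<open>Parity of linear maps\<close>

definition homog :: "bit \<Rightarrow> ('h \<Rightarrow> 'a) \<Rightarrow> bool" where
  "homog i \<phi> \<longleftrightarrow> lin \<phi> \<and> (\<forall>j. \<forall>x\<in>gr H j. \<phi> x \<in> gr A (i + j))"

lemma homog_lin: "homog i \<phi> \<Longrightarrow> lin \<phi>"
  by (simp add: homog_def)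

lemma map_part_eq: "map_part H A i \<phi> f = part A i (\<phi> (part H 0 f)) + part A (i + 1) (\<phi> (part H 1 f))"
  by (simp add: map_part_def)

lemma map_part_homog: "lin \<phi> \<Longrightarrow> homog i (map_part H A i \<phi>)"
  unfolding homog_def
proof (intro conjI allI ballI)
  assume "lin \<phi>"
  then show "lin (map_part H A i \<phi>)"
    by (simp add: lin_iff map_part_eq A.scalar.scale_right_distrib algebra_simps)
  fix j x assume "x \<in> gr H j"
  \<comment> \<open>On an argument of parity \<open>j\<close> the other summand of
    \<open>map_part\<close> is evaluated at 0.\<close>
  then have "map_part H A i \<phi> x = part A (i + j) (\<phi> x)"
    using \<open>lin \<phi>\<close> by (cases j) (simp_all add: map_part_eq H.part_gr lin_0)
  then show "map_part H A i \<phi> x \<in> gr A (i + j)" by simp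
qed

text \<open>Each of the four components of \<phi>, indexed by the parities of argument and value,
  occurs in exactly one of the two parts; regrouping them by the parity of the argument recovers
  \<phi>.\<close>

lemma map_part_sum:
  assumes "lin \<phi>" shows "map_part H A 0 \<phi> + map_part H A 1 \<phi> = \<phi>"
proof
  fix f
  have "(map_part H A 0 \<phi> + map_part H A 1 \<phi>) f =
      (part A 0 (\<phi> (part H 0 f)) + part A 1 (\<phi> (part H 0 f))) +
      (part A 0 (\<phi> (part H 1 f)) + part A 1 (\<phi> (part H 1 f)))"
    by (simp add: map_part_eq algebra_simps)
  also have "\<dots> = \<phi> (part H 0 f + part H 1 f)"
    using assms by (simp add: A.part_sum lin_iff)
  finally show "(map_part H A 0 \<phi> + map_part H A 1 \<phi>) f = \<phi> f" by (simp add: H.part_sum)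
qed

lemma map_part_add: "map_part H A i (\<phi> + \<psi>) = map_part H A i \<phi> + map_part H A i \<psi>"
  by (auto simp: map_part_eq algebra_simps)

lemma map_part_of_homog: "homog j \<phi> \<Longrightarrow> map_part H A i \<phi> = (if i = j then \<phi> else 0)"
proof -
  assume \<phi>: "homog j \<phi>"
  then have "lin \<phi>" by (rule homog_lin)
  have gr: "\<phi> (part H k f) \<in> gr A (j + k)" for k f
    using \<phi> by (auto simp: homog_def)
  have sum: "\<phi> (part H 0 f) + \<phi> (part H 1 f) = \<phi> f" for f
    using \<open>lin \<phi>\<close> H.part_sum[of f] by (metis lin_iff)
  have "map_part H A i \<phi> f = (if i = j then \<phi> f else 0)" for f
    using gr[of 0 f] gr[of 1 f] sum
    by (cases i; cases j) (auto simp: map_part_eq A.part_gr)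
  then show ?thesis by (auto simp: zero_fun_def)
qed

text \<open>Every linear map is the sum of its even and odd parts, so additive identities have to be
  checked on homogeneous maps, where the sign is a fixed power.\<close>

lemma lin_homog_induct [consumes 1, case_names homog add]:
  assumes "lin \<phi>" "\<And>i \<phi>. homog i \<phi> \<Longrightarrow> P \<phi>"
    "\<And>\<phi> \<psi>. lin \<phi> \<Longrightarrow> lin \<psi> \<Longrightarrow> P \<phi> \<Longrightarrow> P \<psi> \<Longrightarrow> P (\<phi> + \<psi>)"
  shows "P \<phi>"
  by (metis assms map_part_sum map_part_homog homog_lin)

section \<open>Unsigned convolution\<close>

text \<open>The signed convolution reduces to the unsigned one by twisting the left factor
  with the parity involution of \<open>H\<close>, which is a coalgebra automorphism.\<close>

definition uconv :: "('h \<Rightarrow> 'a) \<Rightarrow> ('h \<Rightarrow> 'a) \<Rightarrow> 'h \<Rightarrow> 'a" where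
  "uconv \<phi> \<psi> f = flift (smult A) (\<lambda>(x, y). \<phi> x * \<psi> y) (comult H f)"

text \<open>The product of two linear maps is bilinear in the tensor factors. Hence any
  representative of \<open>\<Delta>(f)\<close> gives the same value, and the coalgebra axioms, which
  hold only up to \<open>tensor2_eq\<close>, apply to convolutions.\<close>

lemma flift_comult_eq:
  assumes "lin \<phi>" "lin \<psi>" "tensor2_eq H t t'"
  shows "flift (smult A) (\<lambda>(x, y). \<phi> x * \<psi> y) t = flift (smult A) (\<lambda>(x, y). \<phi> x * \<psi> y) t'"
  by (rule flift_tensor2_eq[OF A.vector_space assms(3)])
    (use assms(1,2) in \<open>auto simp: lin_iff algebra_simps A.smult_mult_left A.smult_mult_right\<close>)

lemma uconv_lin:
  assumes "lin \<phi>" "lin \<psi>" shows "lin (uconv \<phi> \<psi>)"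
proof -
  interpret L: Vector_Spaces.linear fscale "smult A" "flift (smult A) (\<lambda>(x, y). \<phi> x * \<psi> y)"
    by (rule A.scalar.flift_linear)
  show ?thesis
    unfolding lin_iff uconv_def
    by (simp add: flift_comult_eq[OF assms H.comult_add] flift_comult_eq[OF assms H.comult_smult]
        L.add L.scale)
qed

text \<open>\<open>\<Delta>\<close> preserves parity, so its value may be represented by a
  combination of pure tensors of the right total parity; on each of these the parities of maps and
  arguments add up.\<close>

lemma uconv_homog:
  assumes "homog i \<phi>" "homog j \<psi>" shows "homog (i + j) (uconv \<phi> \<psi>)"
  unfolding homog_def
proof (intro conjI allI ballI)
  show "lin (uconv \<phi> \<psi>)" using assms by (simp add: uconv_lin homog_lin)
  fix l x assume "x \<in> gr H l"
  then obtain t where t: "t \<in> tensor2_gr H l" "tensor2_eq H (comult H x) t"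
    using H.comult_gr by blast
  let ?L = "flift (smult A) (\<lambda>(x, y). \<phi> x * \<psi> y)"
  interpret L: Vector_Spaces.linear fscale "smult A" ?L
    by (rule A.scalar.flift_linear)
  have "?L t \<in> gr A (i + j + l)"
    using t(1) unfolding tensor2_gr_def
  proof (induction rule: fscale.span_induct)
    case base
    \<comment> \<open>The preimage of a graded piece under a linear map is a subspace, which reduces
      the claim to generators.\<close>
    show ?case using A.gr_subspace by (intro L.subspace_vimage[unfolded vimage_def])
  next
    case (step z)
    then obtain x y k m where z: "z = pure (x, y)" "x \<in> gr H k" "y \<in> gr H m" "l = k + m" by blast
    have "(i + k) + (j + m) = i + j + l" unfolding z by (simp only: ac_simps)
    moreover have "\<phi> x * \<psi> y \<in> gr A ((i + k) + (j + m))"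
      using assms z by (intro A.gr_mult) (simp_all add: homog_def)
    ultimately have "\<phi> x * \<psi> y \<in> gr A (i + j + l)" by metis
    then show ?case by (simp add: z(1))
  qed
  then show "uconv \<phi> \<psi> x \<in> gr A (i + j + l)"
    using flift_comult_eq[OF assms[THEN homog_lin] t(2)] by (simp add: uconv_def)
qed

section \<open>Twisting by the parity involution\<close>

abbreviation twist :: "bit \<Rightarrow> ('h \<Rightarrow> 'a) \<Rightarrow> 'h \<Rightarrow> 'a" where
  "twist i \<phi> \<equiv> \<phi> \<circ> parity_pow H i"

lemma twist_lin: "lin \<phi> \<Longrightarrow> lin (twist i \<phi>)"
  using H.parity_pow_linear Vector_Spaces.linear_compose by blast

lemma twist_twist: "twist i (twist j \<phi>) = twist (i + j) \<phi>"
  by (simp add: fun_eq_iff H.parity_pow_parity_pow add.commute)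

text \<open>On an element of parity \<open>l\<close> the left side contributes
  \<open>koszul i l\<close>. The right side contributes \<open>koszul i j * koszul i k\<close> on
  pure tensors of parities \<open>j\<close> and \<open>k\<close> with \<open>j + k = l\<close>, and
  these signs agree because \<open>koszul\<close> is multiplicative in its second argument.\<close>

lemma twist_uconv:
  assumes "lin \<phi>" "lin \<psi>"
  shows "twist i (uconv \<phi> \<psi>) = uconv (twist i \<phi>) (twist i \<psi>)"
proof (rule H.homogeneous_eqI)
  show "lin (twist i (uconv \<phi> \<psi>))" "lin (uconv (twist i \<phi>) (twist i \<psi>))"
    using assms by (simp_all add: twist_lin uconv_lin)
  fix l x assume x: "x \<in> gr H l"
  then obtain t where t: "t \<in> tensor2_gr H l" "tensor2_eq H (comult H x) t"
    using H.comult_gr by blast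
  let ?L = "flift (smult A) (\<lambda>(x, y). \<phi> x * \<psi> y)"
  let ?M = "flift (smult A) (\<lambda>(x, y). twist i \<phi> x * twist i \<psi> y)"
  have "?M t = smult A (koszul i l) (?L t)"
  proof (rule linear_eqI_span[OF _ _ _ t(1)[unfolded tensor2_gr_def]])
    show "Vector_Spaces.linear fscale (smult A) ?M" by (rule A.scalar.flift_linear)
    show "Vector_Spaces.linear fscale (smult A) (\<lambda>t. smult A (koszul i l) (?L t))"
      using A.scalar.flift_linear A.scalar.linear_scale_self Vector_Spaces.linear_compose
      unfolding comp_def by fast
    fix z :: "'h \<times> 'h \<Rightarrow>\<^sub>0 'k" assume "z \<in> {pure (x, y) |x y j k. x \<in> gr H j \<and> y \<in> gr H k \<and> j + k = l}"
    then obtain x y j k where z: "z = pure (x, y)" "x \<in> gr H j" "y \<in> gr H k" "l = j + k" by blast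
    have "(koszul i j * koszul i k :: 'k) = koszul i l"
      unfolding z by (cases i; cases j; cases k) (auto simp: koszul_def)
    then show "?M z = smult A (koszul i l) (?L z)"
      using z assms by (auto simp: lin_iff H.parity_pow_gr A.smult_mult_left A.smult_mult_right
          mult.commute)
  qed
  then have "uconv (twist i \<phi>) (twist i \<psi>) x = smult A (koszul i l) (uconv \<phi> \<psi> x)"
    using flift_comult_eq[OF assms t(2)] flift_comult_eq[OF assms[THEN twist_lin] t(2)]
    by (simp add: uconv_def)
  then show "twist i (uconv \<phi> \<psi>) x = uconv (twist i \<phi>) (twist i \<psi>) x"
    using uconv_lin[OF assms] by (simp add: H.parity_pow_gr[OF x] lin_iff)
qed

text \<open>Right multiplication by a fixed element is linear and passes through the inner formal
  sum, so bracketing to the left matches \<open>(\<Delta> \<otimes> id) \<Delta>\<close>. This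
  connects the threefold sum in \<open>Ad\<close> with convolution.\<close>

lemma uconv_uconv_comult3:
  "uconv (uconv \<phi> \<psi>) \<chi> f = flift (smult A) (\<lambda>(x, y, z). \<phi> x * \<psi> y * \<chi> z) (comult3 H f)"
proof -
  have "uconv \<phi> \<psi> x * \<chi> y =
      flift (smult A) (\<lambda>(a, b). \<phi> a * \<psi> b * \<chi> y) (comult H x)" for x y
  proof -
    have "Vector_Spaces.linear (smult A) (smult A) (\<lambda>w. w * \<chi> y)"
      by (simp add: Vector_Spaces.linear_iff A.vector_space A.smult_mult_left algebra_simps)
    from linear_flift[OF this] show ?thesis by (simp add: uconv_def case_prod_unfold)
  qed
  then show ?thesis
    unfolding comult3_def uconv_def[of "uconv \<phi> \<psi>"]
    by (simp add: linear_flift[OF A.scalar.flift_linear] case_prod_unfold)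
qed

text \<open>Bracketing to the right corresponds to \<open>(id \<otimes> \<Delta>) \<Delta>\<close>;
  coassociativity identifies the two threefold tensors, and the product of three linear maps is
  trilinear.\<close>

lemma uconv_assoc:
  assumes "lin \<phi>" "lin \<psi>" "lin \<chi>"
  shows "uconv (uconv \<phi> \<psi>) \<chi> = uconv \<phi> (uconv \<psi> \<chi>)"
proof
  fix f
  let ?B = "\<lambda>(x, y, z). \<phi> x * \<psi> y * \<chi> z"
  have "\<phi> x * uconv \<psi> \<chi> y =
      flift (smult A) (\<lambda>(a, b). \<phi> x * \<psi> a * \<chi> b) (comult H y)" for x y
  proof -
    have "Vector_Spaces.linear (smult A) (smult A) (\<lambda>w. \<phi> x * w)"
      by (simp add: Vector_Spaces.linear_iff A.vector_space A.smult_mult_right algebra_simps)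
    from linear_flift[OF this] show ?thesis by (simp add: uconv_def case_prod_unfold mult.assoc)
  qed
  then have "uconv \<phi> (uconv \<psi> \<chi>) f = flift (smult A) ?B
      (flift fscale (\<lambda>(a, b). flift fscale (\<lambda>(c, d). pure (a, c, d)) (comult H b)) (comult H f))"
    unfolding uconv_def[of \<phi> "uconv \<psi> \<chi>"]
    by (simp add: linear_flift[OF A.scalar.flift_linear] case_prod_unfold)
  also have "\<dots> = flift (smult A) ?B (comult3 H f)"
    by (rule flift_tensor3_eq[OF A.vector_space H.coassoc, symmetric])
      (use assms in \<open>auto simp: lin_iff algebra_simps A.smult_mult_left A.smult_mult_right\<close>)
  finally show "uconv (uconv \<phi> \<psi>) \<chi> f = uconv \<phi> (uconv \<psi> \<chi>) f"
    by (simp add: uconv_uconv_comult3)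
qed

section \<open>Signed convolution\<close>

abbreviation cv :: "('h \<Rightarrow> 'a) \<Rightarrow> ('h \<Rightarrow> 'a) \<Rightarrow> 'h \<Rightarrow> 'a" (infixl "\<star>" 70) where
  "\<phi> \<star> \<psi> \<equiv> conv H A \<phi> \<psi>"

lemma conv_add_left: "(\<phi> + \<phi>') \<star> \<psi> = \<phi> \<star> \<psi> + \<phi>' \<star> \<psi>"
  by (simp add: fun_eq_iff conv_def case_prod_unfold algebra_simps A.scalar.scale_right_distrib
      flip: A.scalar.flift_fun_add)

lemma conv_add_right: "\<phi> \<star> (\<psi> + \<psi>') = \<phi> \<star> \<psi> + \<phi> \<star> \<psi>'"
  by (simp add: fun_eq_iff conv_def case_prod_unfold algebra_simps A.scalar.scale_right_distrib
      map_part_add flip: A.scalar.flift_fun_add)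

lemma conv_diff_left: "(\<phi> - \<phi>') \<star> \<psi> = \<phi> \<star> \<psi> - \<phi>' \<star> \<psi>"
  using conv_add_left[of "\<phi> - \<phi>'" \<phi>' \<psi>] by simp

lemma conv_diff_right: "\<phi> \<star> (\<psi> - \<psi>') = \<phi> \<star> \<psi> - \<phi> \<star> \<psi>'"
  using conv_add_right[of \<phi> "\<psi> - \<psi>'" \<psi>'] by simp

text \<open>Turns the explicit sign sums in \<open>conv\<close> and \<open>Ad\<close> into a twist
  of the map applied to the first tensor factor.\<close>

lemma koszul_parts:
  assumes "lin \<phi>"
  shows "(\<Sum>j\<in>{0, 1}. smult A (koszul i j) (\<phi> (part H j x))) = twist i \<phi> x"
proof -
  have "\<phi> (part H 0 x) + \<phi> (part H 1 x) = \<phi> x"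
    using assms H.part_sum[of x] by (metis lin_iff)
  moreover have "\<phi> (part H 0 x) - \<phi> (part H 1 x) = \<phi> (part H 0 x - part H 1 x)"
    using assms by (metis lin_iff add_diff_cancel_right' diff_add_cancel)
  ultimately show ?thesis by (cases i) (simp_all add: koszul_def parity_pow_def)
qed

text \<open>Among the parts of \<psi> only the one of parity \<open>i\<close> survives. The
  remaining sign depends only on the first tensor factor and is absorbed into the left map.\<close>

lemma conv_homog:
  assumes "lin \<phi>" "homog i \<psi>" shows "\<phi> \<star> \<psi> = uconv (twist i \<phi>) \<psi>"
proof -
  have "(\<Sum>k\<in>{0,1}. \<Sum>j\<in>{0,1}. smult A (koszul k j) (\<phi> (part H j x) * map_part H A k \<psi> y)) =
      twist i \<phi> x * \<psi> y" for x y
    using assms(2) koszul_parts[OF assms(1), of i x, symmetric]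
    by (cases i) (auto simp: map_part_of_homog algebra_simps A.smult_mult_left)
  then show ?thesis by (simp add: fun_eq_iff conv_def uconv_def)
qed

lemma conv_lin: "lin \<phi> \<Longrightarrow> lin \<psi> \<Longrightarrow> lin (\<phi> \<star> \<psi>)"
  \<comment> \<open>Rotating the premises makes the induction run on \<psi>, the factor whose parity
    determines the sign.\<close>
  by (rotate_tac, induction rule: lin_homog_induct)
    (auto simp: conv_homog conv_add_right homog_lin intro!: uconv_lin twist_lin lin_add)

lemma twist_homog: "homog i \<phi> \<Longrightarrow> homog i (twist k \<phi>)"
  using twist_lin[of \<phi> k] by (auto simp: homog_def H.parity_pow_gr A.gr_smult lin_iff[of \<phi>])

lemma homog_conv: "homog i \<phi> \<Longrightarrow> homog j \<psi> \<Longrightarrow> homog (i + j) (\<phi> \<star> \<psi>)"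
  by (auto simp: conv_homog homog_lin intro!: uconv_homog twist_homog)

text \<open>The two right factors are decomposed, since their parities \<open>j\<close> and
  \<open>k\<close> determine all twists. The twist by \<open>j + k\<close> on \<phi> splits into one
  by \<open>j\<close>, which belongs to the product of \<phi> and \<psi>, and one by
  \<open>k\<close>, which acts on that whole product.\<close>

lemma conv_assoc:
  assumes "lin \<phi>" "lin \<psi>" "lin \<chi>"
  shows "\<phi> \<star> \<psi> \<star> \<chi> = \<phi> \<star> (\<psi> \<star> \<chi>)"
  using assms(3)
proof (induction \<chi> rule: lin_homog_induct)
  case (homog k \<chi>)
  from assms(2) show ?case
  proof (induction \<psi> rule: lin_homog_induct)
    case (homog j \<psi>)
    have "homog (j + k) (\<psi> \<star> \<chi>)" using homog \<open>homog k \<chi>\<close> by (rule homog_conv)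
    then have "\<phi> \<star> (\<psi> \<star> \<chi>) = uconv (twist (j + k) \<phi>) (uconv (twist k \<psi>) \<chi>)"
      using assms(1) homog \<open>homog k \<chi>\<close> by (simp add: conv_homog homog_lin)
    also have "\<dots> = uconv (uconv (twist k (twist j \<phi>)) (twist k \<psi>)) \<chi>"
      using assms(1) homog \<open>homog k \<chi>\<close>
      by (simp only: twist_twist uconv_assoc twist_lin homog_lin add.commute)
    \<comment> \<open>The outer twist is pulled out of both factors by its compatibility with
      unsigned convolution.\<close>
    also have "\<dots> = uconv (twist k (\<phi> \<star> \<psi>)) \<chi>"
      using assms(1) homog by (simp only: twist_uconv conv_homog twist_lin homog_lin)
    also have "\<dots> = \<phi> \<star> \<psi> \<star> \<chi>"
      using assms(1) homog \<open>homog k \<chi>\<close> by (simp only: conv_homog[of "\<phi> \<star> \<psi>"] conv_lin homog_lin)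
    finally show ?case by simp
  qed (simp only: conv_add_left conv_add_right)
qed (simp only: conv_add_right)

section \<open>The unit of the convolution algebra\<close>

definition cunit :: "'h \<Rightarrow> 'a" where
  "cunit f = smult A (counit H f) 1"

lemma twist_0 [simp]: "twist 0 \<phi> = \<phi>"
  by (simp add: fun_eq_iff parity_pow_def)

lemma cunit_homog: "homog 0 cunit"
  unfolding homog_def
proof (intro conjI allI ballI)
  show "lin cunit"
    using H.counit_linear
    by (simp add: lin_iff Vector_Spaces.linear_iff[of _ "(*)"] cunit_def A.scalar.scale_left_distrib
        A.vector_space)
  fix j x assume "x \<in> gr H j"
  then show "cunit x \<in> gr A (0 + j)"
    by (cases j) (auto simp: cunit_def H.counit_odd A.gr_smult A.gr_one A.gr_zero)
qed

text \<open>The counit vanishes on odd elements, so twisting leaves it unchanged; what remains is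
  the left counit axiom with \<phi> applied to it.\<close>

lemma conv_cunit_left:
  assumes "lin \<phi>" shows "cunit \<star> \<phi> = \<phi>"
  using assms
proof (induction rule: lin_homog_induct)
  case (homog i \<phi>)
  have "twist i cunit = cunit"
  proof (rule H.homogeneous_eqI)
    show "lin (twist i cunit)" "lin cunit" using cunit_homog by (auto intro: twist_lin homog_lin)
    fix j x assume "x \<in> gr H j"
    moreover have "counit H (smult H c x) = c * counit H x" for c
      using H.counit_linear by (simp add: Vector_Spaces.linear_iff)
    ultimately show "twist i cunit x = cunit x"
      by (cases j) (auto simp: H.parity_pow_gr koszul_def cunit_def H.counit_odd
          simp del: H.scalar.scale_minus_left)
  qed
  then have "cunit \<star> \<phi> = uconv cunit \<phi>"
    using homog by (simp only: conv_homog homog_lin[OF cunit_homog])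
  moreover have "uconv cunit \<phi> f = \<phi> f" for f
  proof -
    have "\<phi> (flift (smult H) (\<lambda>(a, b). smult H (counit H a) b) (comult H f)) =
        flift (smult A) (\<lambda>(a, b). smult A (counit H a) (\<phi> b)) (comult H f)"
      using homog_lin[OF homog]
      by (simp add: linear_flift[OF homog_lin[OF homog]] case_prod_unfold lin_iff)
    then show ?thesis by (simp add: uconv_def cunit_def A.smult_mult_left H.counit_left)
  qed
  ultimately show ?case by (simp add: fun_eq_iff)
qed (simp only: conv_add_right)

section \<open>The adjoint action as conjugation\<close>

context
  fixes g :: "'h \<Rightarrow> 'a"
  assumes g: "superalgebra_hom H A g"
begin

lemma hom_lin: "lin g"
  using g by (simp add: superalgebra_hom_def)

lemma hom_homog: "homog 0 g"
  using g by (auto simp: superalgebra_hom_def homog_def)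

lemma hom_antipode_homog: "homog 0 (g \<circ> antipode H)"
  using hom_homog H.antipode_gr Vector_Spaces.linear_compose[OF H.antipode_linear]
  by (auto simp: homog_def)

text \<open>This is \<open>g\<close> applied to the left antipode axiom: \<open>g\<close> is
  multiplicative and unital, and being even it causes no sign.\<close>

lemma conv_antipode_left: "(g \<circ> antipode H) \<star> g = cunit"
proof -
  have "g (smult H c 1) = smult A c 1" for c
    using g hom_lin by (simp add: superalgebra_hom_def lin_iff)
  then show ?thesis
    using g H.antipode_left
      linear_flift[OF hom_lin, of "\<lambda>(a, b). antipode H a * b", symmetric]
    by (simp add: fun_eq_iff conv_homog[OF homog_lin[OF hom_antipode_homog] hom_homog]
        uconv_def cunit_def superalgebra_hom_def case_prod_unfold)
qed

text \<open>Since \<open>g \<circ> antipode H\<close> is even, the outer convolution carries no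
  sign. The sign between \<open>u\<close> and the first tensor factor is exactly that of the
  convolution of \<open>g\<close> with \<open>u\<close>.\<close>

lemma Ad_eq_conv:
  assumes "lin u" shows "Ad H A g u = g \<star> u \<star> (g \<circ> antipode H)"
proof -
  let ?s = "g \<circ> antipode H"
  let ?T = "\<lambda>i (x, y, z). twist i g x * map_part H A i u y * ?s z"
  have u: "homog i (map_part H A i u)" for i using assms by (rule map_part_homog)
  have "(\<Sum>j\<in>{0,1}. smult A (koszul i j) (g (part H j x) * w * ?s z)) =
      twist i g x * w * ?s z" for i x z w
    by (simp only: A.smult_mult_left[symmetric] sum_distrib_right[symmetric] koszul_parts[OF hom_lin])
  then have "Ad H A g u f = flift (smult A) (\<lambda>b. ?T 0 b + ?T 1 b) (comult3 H f)" for f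
    by (simp add: Ad_def case_prod_unfold del: twist_0 comp_apply) (simp add: comp_def)
  then have "Ad H A g u f = uconv (g \<star> map_part H A 0 u) ?s f + uconv (g \<star> map_part H A 1 u) ?s f" for f
    by (simp only: A.scalar.flift_fun_add uconv_uconv_comult3 conv_homog[OF hom_lin u])
  then have "Ad H A g u = g \<star> map_part H A 0 u \<star> ?s + g \<star> map_part H A 1 u \<star> ?s"
    by (simp add: fun_eq_iff conv_homog[OF _ hom_antipode_homog] conv_lin hom_lin homog_lin[OF u])
  \<comment> \<open>The two parts of \<open>u\<close> are put back together by biadditivity.\<close>
  then show ?thesis
    by (simp only: conv_add_left[symmetric] conv_add_right[symmetric] map_part_sum[OF assms])
qed

lemma Ad_homog: "homog i u \<Longrightarrow> homog i (Ad H A g u)"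
  using homog_conv[OF homog_conv[OF hom_homog, of i u] hom_antipode_homog]
  by (simp add: Ad_eq_conv homog_lin)

lemma Ad_add: "lin u \<Longrightarrow> lin v \<Longrightarrow> Ad H A g (u + v) = Ad H A g u + Ad H A g v"
  by (simp add: Ad_eq_conv lin_add conv_add_left conv_add_right)

lemma Ad_diff: "lin u \<Longrightarrow> lin v \<Longrightarrow> Ad H A g (u - v) = Ad H A g u - Ad H A g v"
  by (simp add: Ad_eq_conv lin_diff conv_diff_left conv_diff_right)

text \<open>Conjugation by even maps preserves parity, so it commutes with taking parts. This
  matters because the bracket is defined through the parts of its arguments.\<close>

lemma map_part_Ad:
  assumes "lin u" shows "map_part H A i (Ad H A g u) = Ad H A g (map_part H A i u)"
  using assms
proof (induction rule: lin_homog_induct)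
  case (homog j u)
  \<comment> \<open>Covers the parity in which the homogeneous map \<open>u\<close> has part
    0.\<close>
  have Ad_0: "Ad H A g 0 = 0" using Ad_diff[of u u] homog by (simp add: homog_lin)
  show ?case
    by (simp only: map_part_of_homog[OF homog] map_part_of_homog[OF Ad_homog[OF homog]]
        if_distrib[of "Ad H A g"] Ad_0)
qed (simp only: Ad_add map_part_add map_part_homog[THEN homog_lin])

text \<open>In the product of the two conjugates the inner factors
  \<open>g \<circ> antipode H\<close> and \<open>g\<close> become adjacent by associativity and
  cancel to the unit.\<close>

lemma Ad_conv:
  assumes "lin u" "lin v"
  shows "Ad H A g u \<star> Ad H A g v = Ad H A g (u \<star> v)"
proof -
  let ?s = "g \<circ> antipode H"
  have s: "lin ?s" by (rule homog_lin[OF hom_antipode_homog])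
  have "g \<star> u \<star> ?s \<star> (g \<star> v \<star> ?s) = g \<star> u \<star> (?s \<star> g \<star> (v \<star> ?s))"
    using assms s hom_lin by (simp add: conv_assoc conv_lin)
  also have "\<dots> = g \<star> (u \<star> v) \<star> ?s"
    using assms s hom_lin by (simp add: conv_antipode_left conv_cunit_left conv_assoc conv_lin)
  finally show ?thesis using assms by (simp add: Ad_eq_conv conv_lin)
qed

text \<open>The four sign cases written out: only the pair of odd parts has Koszul sign -1, hence
  the single minus inside the parentheses. In this form the bracket consists of operations that
  \<open>Ad\<close> respects.\<close>

lemma lie_bracket_eq:
  "lie_bracket H A u v = u \<star> v -
     (map_part H A 0 v \<star> map_part H A 0 u + map_part H A 1 v \<star> map_part H A 0 u +
      map_part H A 0 v \<star> map_part H A 1 u - map_part H A 1 v \<star> map_part H A 1 u)"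
  by (simp add: fun_eq_iff lie_bracket_def koszul_def)

lemma Ad_lie_bracket:
  assumes "lin u" "lin v"
  shows "lie_bracket H A (Ad H A g u) (Ad H A g v) = Ad H A g (lie_bracket H A u v)"
proof -
  have "lin (map_part H A i u)" "lin (map_part H A i v)" for i
    using assms by (simp_all add: homog_lin[OF map_part_homog])
  with assms show ?thesis
    by (simp only: lie_bracket_eq map_part_Ad Ad_conv Ad_add Ad_diff conv_lin lin_add lin_diff)
qed

end

end

theorem lemma2p3:
  fixes G :: "('k::field, 'h::{ring,monoid_mult}) hopf"
    and A :: "('k, 'a::{ring,monoid_mult}) superspace"
    and g u v :: "'h \<Rightarrow> 'a"
  assumes "CHAR('k) \<noteq> 2"
    and "algebraic_supergroup G"
    and "supercommutative_superalgebra A"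
    and "g \<in> points G A"
    and "u \<in> lie_maps G A" and "v \<in> lie_maps G A"
  shows "lie_bracket G A (Ad G A g u) (Ad G A g v) = Ad G A g (lie_bracket G A u v)"
proof -
  interpret convolution G A
    using assms(2,3) by (simp add: convolution_def algebraic_supergroup_def
        supercommutative_superalgebra_def)
  show ?thesis
    using assms(4-6) by (intro Ad_lie_bracket) (auto simp: points_def lie_maps_def)
qed

end
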